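(* Let $M=\bar M=\mathbb{R}^3$, equipped with probability densities $\rho(x)$ on $M$ and $\bar\rho(\bar x)$ on $\bar M$, and let the cost be $c(x,\bar x)=-x\cdot\bar x$. Let $h_c^{\rho,\bar\rho}$ be the Kim-McCann-Warren metric on $M\times\bar M$, and let $g_\alpha$ be the Lychagin-Rubtsov metric on $T^*M\simeq M\times\bar M$ associated with the Monge-Ampère structure $(\omega_c,\alpha)$, where $\omega_c$ is the symplectic form determined by $c$ and $\alpha$ is the effective $3$-form corresponding to the Monge-Ampère equation $\bar\rho(Du(x))\det(D^2u(x))=\rho(x)$. Then, as symmetric $(0,2)$-tensor fields on $M\times\bar M$, $$g_\alpha=[\rho(x)\bar\rho(\bar x)]^{2/3}\,h_c^{\rho,\bar\rho}.$$
   Context: Setting. $M$ and $\bar M$ are $n$-dimensional with coordinates $x=(x^1,\dots,x^n)$ and $\bar x=(\bar x^1,\dots,\bar x^n)$ (here $n=3$), and $c:M\times\bar M\to\mathbb{R}$ is a smooth cost function. $D_xD_{\bar x}c$ denotes the $n\times n$ matrix of mixed derivatives $\partial^2c/\partial x^i\partial\bar x^j$. Block matrices below are with respect to the coordinates $(x,\bar x)$, and a matrix $B$ denotes the bilinear form $(V,W)\mapsto V^TBW$. Symplectic form on $M\times\bar M$: $$\omega_c=\begin{pmatrix}0&-D_xD_{\bar x}c\\(D_xD_{\bar x}c)^T&0\end{pmatrix}.$$ For $c=-x\cdot\bar x$ this is $\omega_c=\sum_i dx^i\wedge d\bar x^i$. Kim-McCann-Warren metric on $M\times\bar M$: $$h_c^{\rho,\bar\rho}=\left(\frac{\rho(x)\bar\rho(\bar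 x)}{|\det(D_xD_{\bar x}c)|}\right)^{1/n}\begin{pmatrix}0&-D_xD_{\bar x}c\\-(D_xD_{\bar x}c)^T&0\end{pmatrix}.$$ Identification. $T^*M$ is identified with $M\times\bar M$ by letting $\bar x$ be the fibre coordinate (covector components), so that for a smooth function $u$ on $M$ the section $du$ is the map $x\mapsto(x,\bar x=Du(x))$. $T^*M$ is given the symplectic form $\omega=\omega_c$. Effective form. An $n$-form $\alpha$ on $T^*M$ is effective if $\omega\wedge\alpha=0$. It defines the Monge-Ampère operator $\Delta_\alpha(u)=(du)^*\alpha$, with associated Monge-Ampère equation $\Delta_\alpha(u)=0$. The effective $3$-form $\alpha$ corresponding to $\bar\rho(Du)\det(D^2u)=\rho(x)$ is the one with $$(du)^*\alpha=\big[\bar\rho(Du(x))\det(D^2u(x))-\rho(x)\big]\,dx^1\wedge dx^2\wedge dx^3$$ for all smooth $u$, which may be defined on any open subset of $M$. (The coefficients of $\alpha$ are as regular as $\rho,\bar\rho$.) Lychagin-Rubtsov metric ($n=3$). $g_\alpha$ is the symmetric bilinear form defined by $$g_\alpha(X_1,X_2)\,\frac{\omega\wedge\omega\wedge\omega}{3!}=\iota_{X_1}\alpha\wedge\iota_{X_2}\alpha\wedge\omega$$ for all vector fields $X_1,X_2$ on $T^*M$, where $\iota$ is the interior product. *)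

theory Defs
  imports "HOL-Analysis.Analysis"
begin

section \<open>Calculus in coordinates\<close>

definition directional :: "'a \<Rightarrow> ('a::real_normed_vector \<Rightarrow> real) \<Rightarrow> 'a \<Rightarrow> real"
  where "directional v f x = frechet_derivative f (at x) v"

primrec Ck_on :: "nat \<Rightarrow> 'a::euclidean_space set \<Rightarrow> ('a \<Rightarrow> real) \<Rightarrow> bool"
  where
    "Ck_on 0 S f \<longleftrightarrow> continuous_on S f"
  | "Ck_on (Suc k) S f \<longleftrightarrow>
       (\<forall>x\<in>S. f differentiable at x) \<and> (\<forall>b\<in>Basis. Ck_on k S (directional b f))"

text \<open>Intended for open \<open>S\<close>.\<close>

definition smooth_on :: "'a::euclidean_space set \<Rightarrow> ('a \<Rightarrow> real) \<Rightarrow> bool"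
  where "smooth_on S f \<longleftrightarrow> (\<forall>k. Ck_on k S f)"

definition gradient :: "(real^'n \<Rightarrow> real) \<Rightarrow> real^'n \<Rightarrow> real^'n"
  where "gradient u x = (\<chi> i. directional (axis i 1) u x)"

definition hessian :: "(real^'n \<Rightarrow> real) \<Rightarrow> real^'n \<Rightarrow> real^'n^'n"
  where "hessian u x =
    (\<chi> i j. directional (axis i 1) (directional (axis j 1) u) x)"

definition mixed_hessian :: "((real^'n) \<times> (real^'n) \<Rightarrow> real) \<Rightarrow> (real^'n) \<times> (real^'n) \<Rightarrow> real^'n^'n"
  where "mixed_hessian c z =
    (\<chi> i j. directional (axis i 1, 0) (directional (0, axis j 1) c) z)"


section \<open>Exterior algebra\<close>

text \<open>
  A \<open>k\<close>-form on a vector space is a function of a sequence of vectors that depends only on the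
  first \<open>k\<close> of them, and is multilinear and alternating in these.  A field of forms assigns
  a form to every point; the space is identified with its tangent space at each point.
\<close>

type_synonym 'v form = "(nat \<Rightarrow> 'v) \<Rightarrow> real"

definition is_form :: "nat \<Rightarrow> 'v::real_vector form \<Rightarrow> bool"
  where "is_form k a \<longleftrightarrow>
    (\<forall>v w. (\<forall>i<k. v i = w i) \<longrightarrow> a v = a w) \<and>
    (\<forall>v. \<forall>i<k. linear (\<lambda>x. a (v(i := x)))) \<and>
    (\<forall>v. \<forall>i<k. \<forall>j<k. i \<noteq> j \<and> v i = v j \<longrightarrow> a v = 0)"

text \<open>
  Exterior product of a \<open>k\<close>-form and an \<open>l\<close>-form, normalised such that
  \<open>(a \<and> b) (V, W) = a V * b W - a W * b V\<close> for 1-forms.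
\<close>

definition wedge :: "nat \<Rightarrow> nat \<Rightarrow> 'v form \<Rightarrow> 'v form \<Rightarrow> 'v form"
  where "wedge k l a b = (\<lambda>v.
    (\<Sum>\<sigma> | \<sigma> permutes {..<k + l}.
       of_int (sign \<sigma>) * a (\<lambda>i. v (\<sigma> i)) * b (\<lambda>i. v (\<sigma> (k + i)))) / (fact k * fact l))"

definition interior_product :: "'v \<Rightarrow> 'v form \<Rightarrow> 'v form"
  where "interior_product X a = (\<lambda>v. a (case_nat X v))"

definition pullback ::
    "('a::real_normed_vector \<Rightarrow> 'b::real_normed_vector) \<Rightarrow> ('b \<Rightarrow> 'b form) \<Rightarrow> 'a \<Rightarrow> 'a form"
  where "pullback f a x = (\<lambda>v. a (f x) (\<lambda>i. frechet_derivative f (at x) (v i)))"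

definition dcoord :: "'n \<Rightarrow> (real^'n) form"
  where "dcoord i = (\<lambda>v. v 0 $ i)"

definition dx123 :: "(real^3) form"
  where "dx123 = wedge 2 1 (wedge 1 1 (dcoord 1) (dcoord 2)) (dcoord 3)"


section \<open>The symplectic form and the Kim--McCann--Warren metric of a cost\<close>

definition block_form ::
    "real^'n^'n \<Rightarrow> real^'n^'n \<Rightarrow> real^'n^'n \<Rightarrow> real^'n^'n \<Rightarrow>
     (real^'n) \<times> (real^'n) \<Rightarrow> (real^'n) \<times> (real^'n) \<Rightarrow> real"
  where "block_form A B C D V W =
    fst V \<bullet> (A *v fst W) + fst V \<bullet> (B *v snd W) + snd V \<bullet> (C *v fst W) + snd V \<bullet> (D *v snd W)"

definition symplectic_form ::
    "((real^'n) \<times> (real^'n) \<Rightarrow> real) \<Rightarrow> (real^'n) \<times> (real^'n) \<Rightarrow> ((real^'n) \<times> (real^'n)) form"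
  where "symplectic_form c z = (\<lambda>v.
    block_form 0 (- mixed_hessian c z) (transpose (mixed_hessian c z)) 0 (v 0) (v 1))"

definition kmw_metric ::
    "((real^'n) \<times> (real^'n) \<Rightarrow> real) \<Rightarrow> (real^'n \<Rightarrow> real) \<Rightarrow> (real^'n \<Rightarrow> real) \<Rightarrow>
     (real^'n) \<times> (real^'n) \<Rightarrow> (real^'n) \<times> (real^'n) \<Rightarrow> (real^'n) \<times> (real^'n) \<Rightarrow> real"
  where "kmw_metric c \<rho> \<rho>' z V W =
    (\<rho> (fst z) * \<rho>' (snd z) / \<bar>det (mixed_hessian c z)\<bar>) powr (1 / real CARD('n)) *
    block_form 0 (- mixed_hessian c z) (- transpose (mixed_hessian c z)) 0 V W"

definition prob_density :: "('a::euclidean_space \<Rightarrow> real) \<Rightarrow> bool"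
  where "prob_density f \<longleftrightarrow>
    f \<in> borel_measurable lebesgue \<and> (\<forall>x. 0 \<le> f x) \<and>
    integral\<^sup>N lebesgue (\<lambda>x. ennreal (f x)) = 1"


section \<open>Monge--Ampere structures in dimension three\<close>

type_synonym phase = "(real^3) \<times> (real^3)"

definition effective :: "(phase \<Rightarrow> phase form) \<Rightarrow> (phase \<Rightarrow> phase form) \<Rightarrow> bool"
  where "effective \<omega> \<alpha> \<longleftrightarrow> (\<forall>z. wedge 2 3 (\<omega> z) (\<alpha> z) = (\<lambda>_. 0))"

definition monge_ampere_operator ::
    "(phase \<Rightarrow> phase form) \<Rightarrow> (real^3 \<Rightarrow> real) \<Rightarrow> real^3 \<Rightarrow> (real^3) form"
  where "monge_ampere_operator \<alpha> u = pullback (\<lambda>x. (x, gradient u x)) \<alpha>"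

text \<open>
  No regularity of \<open>\<alpha>\<close> is imposed, since its coefficients are only as regular as the densities.
\<close>

definition corresponding_form ::
    "(phase \<Rightarrow> phase form) \<Rightarrow> (real^3 \<Rightarrow> real) \<Rightarrow> (real^3 \<Rightarrow> real) \<Rightarrow> (phase \<Rightarrow> phase form)"
  where "corresponding_form \<omega> \<rho> \<rho>' = (THE \<alpha>.
    (\<forall>z. is_form 3 (\<alpha> z)) \<and> effective \<omega> \<alpha> \<and>
    (\<forall>U u. open U \<longrightarrow> smooth_on U u \<longrightarrow> (\<forall>x\<in>U.
       monge_ampere_operator \<alpha> u x =
         (\<lambda>v. (\<rho>' (gradient u x) * det (hessian u x) - \<rho> x) * dx123 v))))"

text \<open>
  The defining equation is tensorial in the vector fields, so it is stated pointwise for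
  tangent vectors.
\<close>

definition lychagin_rubtsov_metric ::
    "(phase \<Rightarrow> phase form) \<Rightarrow> (phase \<Rightarrow> phase form) \<Rightarrow> (phase \<Rightarrow> phase \<Rightarrow> phase \<Rightarrow> real)"
  where "lychagin_rubtsov_metric \<omega> \<alpha> = (THE g. \<forall>z.
    bilinear (g z) \<and> (\<forall>X Y. g z X Y = g z Y X) \<and>
    (\<forall>X\<^sub>1 X\<^sub>2.
       (\<lambda>v. g z X\<^sub>1 X\<^sub>2 * (wedge 4 2 (wedge 2 2 (\<omega> z) (\<omega> z)) (\<omega> z) v / fact 3)) =
       wedge 4 2
         (wedge 2 2 (interior_product X\<^sub>1 (\<alpha> z)) (interior_product X\<^sub>2 (\<alpha> z))) (\<omega> z)))"

end

theory Submission
  imports Defs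
begin

text \<open>
  For \<open>c = - x \<bullet> y\<close> the mixed Hessian is \<open>- 1\<close>, so that \<open>\<omega>\<^sub>c = \<Sum> dx\<^sub>i \<and> dy\<^sub>i\<close>.  The 3-form
  \<open>\<alpha> = \<rho>'(y) dy\<^sub>1 \<and> dy\<^sub>2 \<and> dy\<^sub>3 - \<rho>(x) dx\<^sub>1 \<and> dx\<^sub>2 \<and> dx\<^sub>3\<close> is effective and pulls back to the Monge--Ampere
  operator.  It is the only such form: through every point and for every symmetric matrix \<open>H\<close> there is a
  quadratic \<open>u\<close> whose graph of the differential is tangent to \<open>{(v, H v)}\<close>, and an effective 3-form
  that vanishes on all these Lagrangian planes is zero.  Expanding the wedge products in coordinates
  gives \<open>g\<^sub>\<alpha>(X, Y) = \<rho> \<rho>' (X\<^sub>x \<bullet> Y\<^sub>y + X\<^sub>y \<bullet> Y\<^sub>x)\<close>, and the powers of \<open>\<rho> \<rho>'\<close> combine as \<open>2/3 + 1/3 = 1\<close>.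
\<close>

section \<open>Wedge products of covectors\<close>

text \<open>Left unnormalised: the divisor \<open>fact k * fact l\<close> in \<open>wedge\<close>
  then makes up exactly for antisymmetrizing both factors beforehand.\<close>

definition antisymmetrization :: "nat \<Rightarrow> 'v form \<Rightarrow> 'v form"
  where "antisymmetrization n T = (\<lambda>v. \<Sum>\<sigma> | \<sigma> permutes {..<n}. of_int (sign \<sigma>) * T (\<lambda>i. v (\<sigma> i)))"

text \<open>This is the determinant of the matrix with entries \<open>(ls ! i) (v j)\<close>, so the
  lemmas below on permuted and repeated covectors are determinant rules for rows.\<close>

definition covector_wedge :: "('v \<Rightarrow> real) list \<Rightarrow> 'v form"
  where "covector_wedge ls = antisymmetrization (length ls) (\<lambda>v. \<Prod>i<length ls. (ls ! i) (v i))"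

text \<open>Right composition with \<tau> permutes the index set and multiplies every sign by
  \<open>sign \<tau>\<close>, whose square is 1.\<close>

lemma sum_sign_reindex:
  fixes n :: nat
  assumes "\<tau> permutes {..<n}"
  shows "(\<Sum>\<sigma> | \<sigma> permutes {..<n}. of_int (sign \<sigma>) * F (\<sigma> \<circ> \<tau>)) =
    (of_int (sign \<tau>) :: real) * (\<Sum>\<sigma> | \<sigma> permutes {..<n}. of_int (sign \<sigma>) * F \<sigma>)"
proof -
  have perm: "permutation \<sigma>" if "\<sigma> permutes {..<n}" for \<sigma>
    using that by (rule permutes_imp_permutation[OF finite_lessThan])
  have "of_int (sign \<tau>) * (\<Sum>\<sigma> | \<sigma> permutes {..<n}. of_int (sign \<sigma>) * F \<sigma>) =
    of_int (sign \<tau>) * (\<Sum>\<sigma> | \<sigma> permutes {..<n}. of_int (sign (\<sigma> \<circ> \<tau>)) * F (\<sigma> \<circ> \<tau>))"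
    by (subst sum_permutations_compose_right[OF assms]) simp
  also have "\<dots> = (\<Sum>\<sigma> | \<sigma> permutes {..<n}. of_int (sign \<sigma>) * F (\<sigma> \<circ> \<tau>))"
    unfolding sum_distrib_left
    by (intro sum.cong refl) (simp add: sign_compose perm assms flip: mult.assoc of_int_mult)
  finally show ?thesis
    by simp
qed

text \<open>Every pair of block permutations yields the same sum over \<sigma>, and there are
  \<open>fact k * fact l\<close> pairs. Locality of \<open>A\<close> lets the permutation of the
  second block act on its argument unnoticed.\<close>

lemma wedge_antisymmetrization:
  assumes local: "\<And>v w. (\<forall>i<k. v i = w i) \<Longrightarrow> A v = A w"
  shows "wedge k l (antisymmetrization k A) (antisymmetrization l B) =
    antisymmetrization (k + l) (\<lambda>v. A v * B (\<lambda>i. v (k + i)))"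
proof
  fix v :: "nat \<Rightarrow> 'a"
  define P where "P n = {\<sigma>. \<sigma> permutes {..<n::nat}}" for n
  define R where "R = (\<Sum>\<sigma>\<in>P (k + l). of_int (sign \<sigma>) * (A (\<lambda>i. v (\<sigma> i)) * B (\<lambda>i. v (\<sigma> (k + i)))))"
  \<comment> \<open>The permutations \<open>\<tau>\<close> and \<open>\<pi>\<close> of the two blocks are absorbed into \<open>\<sigma>\<close>, at the cost of their signs.\<close>
  have inner: "(\<Sum>\<sigma>\<in>P (k + l). of_int (sign \<sigma>) *
      (A (\<lambda>i. v (\<sigma> (\<tau> i))) * B (\<lambda>i. v (\<sigma> (k + \<pi> i))))) = of_int (sign \<tau>) * of_int (sign \<pi>) * R"
    if \<tau>: "\<tau> \<in> P k" and \<pi>: "\<pi> \<in> P l" for \<tau> \<pi>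
  proof -
    define \<pi>' where "\<pi>' = map_permutation {..<l} ((+) k) \<pi>"
    have inj: "inj_on ((+) k) {..<l}"
      by simp
    have \<pi>'1: "\<pi>' permutes (+) k ` {..<l}"
      unfolding \<pi>'_def using \<pi> by (intro map_permutation_permutes inj_on_imp_bij_betw inj) (simp add: P_def)
    have img: "(+) k ` {..<l} = {k..<k + l}"
      by (simp add: lessThan_atLeast0 add.commute)
    have \<pi>'n: "\<pi>' permutes {..<k + l}"
      using \<pi>'1 unfolding img by (rule permutes_subset) auto
    have \<tau>n: "\<tau> permutes {..<k + l}"
      using \<tau> unfolding P_def by (auto intro: permutes_subset)
    have low: "\<pi>' i = i" if "i < k" for i
      using permutes_not_in[OF \<pi>'1] that unfolding img by auto
    \<comment> \<open>\<open>B\<close> may look at every entry of its argument, so this is required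
      for all \<open>i\<close>, including \<open>i \<ge> l\<close>, where \<pi> fixes
      \<open>i\<close> and \<open>\<pi>'\<close> fixes \<open>k + i\<close>.\<close>
    have high: "\<tau> (\<pi>' (k + i)) = k + \<pi> i" for i
    proof -
      have "\<pi>' (k + i) = k + \<pi> i"
      proof (cases "i < l")
        case True
        then show ?thesis
          unfolding \<pi>'_def using map_permutation_apply[OF inj, of i \<pi>] by simp
      next
        case False
        then have "\<pi> i = i"
          using \<pi> permutes_not_in unfolding P_def by fastforce
        moreover have "\<pi>' (k + i) = k + i"
          using permutes_not_in[OF \<pi>'1] False unfolding img by auto
        ultimately show ?thesis by simp
      qed
      then show ?thesis
        using \<tau> permutes_not_in unfolding P_def by fastforce
    qed
    have sgn: "sign (\<tau> \<circ> \<pi>') = sign \<tau> * sign \<pi>"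
    proof -
      have "sign \<pi>' = sign \<pi>"
        unfolding \<pi>'_def using \<pi> inj by (intro sign_map_permutation) (auto simp: P_def)
      then show ?thesis
        using permutes_imp_permutation[OF finite_lessThan \<pi>'n]
          permutes_imp_permutation[OF finite_lessThan \<tau>n] by (simp add: sign_compose)
    qed
    have "A (\<lambda>i. v (\<sigma> (\<tau> i))) = A (\<lambda>i. v ((\<sigma> \<circ> (\<tau> \<circ> \<pi>')) i))" for \<sigma>
      by (rule local) (simp add: low)
    then have "(\<Sum>\<sigma>\<in>P (k + l). of_int (sign \<sigma>) *
        (A (\<lambda>i. v (\<sigma> (\<tau> i))) * B (\<lambda>i. v (\<sigma> (k + \<pi> i))))) =
      (\<Sum>\<sigma>\<in>P (k + l). of_int (sign \<sigma>) *
        (A (\<lambda>i. v ((\<sigma> \<circ> (\<tau> \<circ> \<pi>')) i)) * B (\<lambda>i. v ((\<sigma> \<circ> (\<tau> \<circ> \<pi>')) (k + i)))))"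
      by (simp add: high)
    also have "\<dots> = of_int (sign (\<tau> \<circ> \<pi>')) * R"
      unfolding R_def P_def
      by (rule sum_sign_reindex[where F = "\<lambda>\<sigma>. A (\<lambda>i. v (\<sigma> i)) * B (\<lambda>i. v (\<sigma> (k + i)))"])
        (rule permutes_compose[OF \<pi>'n \<tau>n])
    finally show ?thesis
      by (simp add: sgn)
  qed
  have "wedge k l (antisymmetrization k A) (antisymmetrization l B) v * (fact k * fact l) =
    (\<Sum>\<sigma>\<in>P (k + l). of_int (sign \<sigma>) *
      (\<Sum>\<tau>\<in>P k. of_int (sign \<tau>) * A (\<lambda>i. v (\<sigma> (\<tau> i)))) *
      (\<Sum>\<pi>\<in>P l. of_int (sign \<pi>) * B (\<lambda>i. v (\<sigma> (k + \<pi> i)))))"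
    by (simp add: wedge_def antisymmetrization_def P_def)
  also have "\<dots> = (\<Sum>\<sigma>\<in>P (k + l). \<Sum>\<tau>\<in>P k. \<Sum>\<pi>\<in>P l. of_int (sign \<tau>) * of_int (sign \<pi>) *
      (of_int (sign \<sigma>) * (A (\<lambda>i. v (\<sigma> (\<tau> i))) * B (\<lambda>i. v (\<sigma> (k + \<pi> i))))))"
    by (simp add: mult.assoc sum_product) (simp add: sum_distrib_left mult_ac)
  also have "\<dots> = (\<Sum>\<tau>\<in>P k. \<Sum>\<pi>\<in>P l. of_int (sign \<tau>) * of_int (sign \<pi>) *
      (\<Sum>\<sigma>\<in>P (k + l). of_int (sign \<sigma>) *
        (A (\<lambda>i. v (\<sigma> (\<tau> i))) * B (\<lambda>i. v (\<sigma> (k + \<pi> i))))))"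
    unfolding sum_distrib_left
    by (simp only: sum.swap[where A = "P (k + l)"])
  also have "\<dots> = (\<Sum>\<tau>\<in>P k. \<Sum>\<pi>\<in>P l. of_int (sign \<tau> * sign \<tau>) * of_int (sign \<pi> * sign \<pi>) * R)"
    by (intro sum.cong refl) (simp only: inner of_int_mult mult_ac)
  also have "\<dots> = R * (fact k * fact l)"
    by (simp add: P_def card_permutations)
  finally show "wedge k l (antisymmetrization k A) (antisymmetrization l B) v =
    antisymmetrization (k + l) (\<lambda>v. A v * B (\<lambda>i. v (k + i))) v"
    by (simp add: R_def P_def antisymmetrization_def)
qed

text \<open>A tensor product of products of evaluations is the product along the concatenated list.
  Exterior products of explicit forms thereby become list concatenations.\<close>

lemma wedge_covector_wedge:
  assumes "length as = k" "length bs = l"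
  shows "wedge k l (covector_wedge as) (covector_wedge bs) = covector_wedge (as @ bs)"
proof -
  have split: "(\<Prod>i<k + l. ((as @ bs) ! i) (v i)) =
    (\<Prod>i<k. (as ! i) (v i)) * (\<Prod>i<l. (bs ! i) (v (k + i)))" for v
  proof -
    have "(\<Prod>i<k + l. ((as @ bs) ! i) (v i)) =
      (\<Prod>i<k. ((as @ bs) ! i) (v i)) * (\<Prod>i<l. ((as @ bs) ! (k + i)) (v (k + i)))"
      by (induction l) (simp_all add: mult_ac)
    then show ?thesis
      using assms by (simp add: nth_append)
  qed
  show ?thesis
    unfolding covector_wedge_def assms length_append
    by (subst wedge_antisymmetrization) (simp_all add: split)
qed

text \<open>Reindexing the product over \<open>i\<close> by \<tau> moves the permutation from the
  list to the summation index, where \<open>sum_sign_reindex\<close> turns it into a sign.\<close>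

lemma covector_wedge_permute:
  assumes \<tau>: "\<tau> permutes {..<length ls}"
  shows "covector_wedge (permute_list \<tau> ls) v = of_int (sign \<tau>) * covector_wedge ls v"
proof -
  have "(\<Prod>i<length ls. (permute_list \<tau> ls ! i) (v (\<sigma> (\<tau> i)))) =
      (\<Prod>i<length ls. (ls ! i) (v (\<sigma> i)))" for \<sigma>
    by (subst prod.permute[OF \<tau>]) (simp add: permute_list_nth[OF \<tau>] o_def)
  then have "covector_wedge ls v = of_int (sign \<tau>) * covector_wedge (permute_list \<tau> ls) v"
    using sum_sign_reindex[OF \<tau>, of "\<lambda>\<sigma>. \<Prod>i<length ls. (permute_list \<tau> ls ! i) (v (\<sigma> i))"]
    by (simp add: covector_wedge_def antisymmetrization_def)
  then show ?thesis
    by (simp flip: mult.assoc of_int_mult)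
qed

lemma covector_wedge_swap:
  "covector_wedge (as @ a # b # bs) v = - covector_wedge (as @ b # a # bs) v"
proof -
  define \<tau> where "\<tau> = Transposition.transpose (length as) (Suc (length as))"
  let ?ls = "as @ b # a # bs"
  have \<tau>: "\<tau> permutes {..<length ?ls}"
    unfolding \<tau>_def by (rule permutes_swap_id) auto
  have "permute_list \<tau> ?ls = as @ a # b # bs"
  proof (rule nth_equalityI)
    fix i assume "i < length (permute_list \<tau> ?ls)"
    then show "permute_list \<tau> ?ls ! i = (as @ a # b # bs) ! i"
      using \<tau>
      by (auto simp: permute_list_nth \<tau>_def Transposition.transpose_def nth_append nth_Cons
          split: nat.splits)
  qed simp
  then show ?thesis
    using covector_wedge_permute[OF \<tau>, of v] by (simp add: \<tau>_def sign_swap_id)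
qed

text \<open>The transposition of two positions with the same entry fixes the list but reverses the
  sign.\<close>

lemma covector_wedge_not_distinct:
  assumes "\<not> distinct ls"
  shows "covector_wedge ls = (\<lambda>_. 0)"
proof
  fix v
  obtain i j where ij: "i < length ls" "j < length ls" "i \<noteq> j" "ls ! i = ls ! j"
    using assms by (auto simp: distinct_conv_nth)
  define \<tau> where "\<tau> = Transposition.transpose i j"
  have \<tau>: "\<tau> permutes {..<length ls}"
    unfolding \<tau>_def using ij by (intro permutes_swap_id) auto
  have "permute_list \<tau> ls = ls"
    by (rule nth_equalityI)
      (use \<tau> ij in \<open>auto simp: permute_list_nth \<tau>_def Transposition.transpose_def\<close>)
  then show "covector_wedge ls v = 0"
    using covector_wedge_permute[OF \<tau>, of v] ij by (simp add: \<tau>_def sign_swap_id)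
qed

text \<open>The matrix of values is the identity, so only the identity permutation contributes to
  the determinant.\<close>

lemma covector_wedge_dual_basis:
  assumes "\<And>i j. i < length ls \<Longrightarrow> j < length ls \<Longrightarrow> (ls ! i) (v j) = of_bool (i = j)"
  shows "covector_wedge ls v = 1"
proof -
  have zero: "(\<Prod>i<length ls. (ls ! i) (v (\<sigma> i))) = 0"
    if \<sigma>: "\<sigma> permutes {..<length ls}" "\<sigma> \<noteq> id" for \<sigma>
  proof -
    obtain i where "\<sigma> i \<noteq> i"
      using \<sigma>(2) by (auto simp: fun_eq_iff)
    moreover from this have "i < length ls"
      using permutes_not_in[OF \<sigma>(1)] by force
    moreover from this have "\<sigma> i < length ls"
      using permutes_in_image[OF \<sigma>(1), of i] by simp
    ultimately show ?thesis
      using assms by (intro prod_zero) (auto intro!: bexI[of _ i])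
  qed
  have "covector_wedge ls v = (\<Sum>\<sigma>\<in>{id}. of_int (sign \<sigma>) * (\<Prod>i<length ls. (ls ! i) (v (\<sigma> i))))"
    unfolding covector_wedge_def antisymmetrization_def
    by (rule sum.mono_neutral_right) (auto simp: finite_permutations zero)
  then show ?thesis
    by (simp add: assms)
qed

section \<open>Explicit expansions in degrees one to three\<close>

lemma covector_wedge_1: "covector_wedge [a] v = a (v 0)"
  by (simp add: covector_wedge_def antisymmetrization_def lessThan_Suc flip: id_def)

lemma covector_wedge_2: "covector_wedge [a, b] v = a (v 0) * b (v 1) - a (v 1) * b (v 0)"
proof -
  have "{\<sigma>. \<sigma> permutes {..<2::nat}} = {id, Transposition.transpose 0 1}"
    by (auto simp: permutes_doubleton_iff numeral_2_eq_2 lessThan_Suc insert_commute)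
  moreover have "id \<noteq> Transposition.transpose 0 (1::nat)"
    by (metis id_apply transpose_apply_first zero_neq_one)
  ultimately show ?thesis
    by (simp add: covector_wedge_def antisymmetrization_def sign_swap_id numeral_2_eq_2)
qed

text \<open>The six permutations are written as products of transpositions so that simplification
  can compute their signs.\<close>

lemma sum_permutes_3:
  assumes "distinct [a, b, c]"
  shows "(\<Sum>\<sigma> | \<sigma> permutes {a, b, c}. F \<sigma>) =
    (\<Sum>\<sigma>\<leftarrow>[id, Transposition.transpose b c, Transposition.transpose a b,
      Transposition.transpose a b \<circ> Transposition.transpose b c,
      Transposition.transpose a c, Transposition.transpose a c \<circ> Transposition.transpose b c]. F \<sigma>)"
proof -
  have ins: "(\<Sum>\<sigma> | \<sigma> permutes {b, c}. G \<sigma>) = G id + G (Transposition.transpose b c)"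
    for G :: "('a \<Rightarrow> 'a) \<Rightarrow> 'b"
  proof -
    have "{\<sigma>. \<sigma> permutes {b, c}} = {id, Transposition.transpose b c}"
      by (auto simp: permutes_doubleton_iff)
    moreover have "id \<noteq> Transposition.transpose b c"
      using assms by (metis distinct_length_2_or_more id_apply transpose_apply_first)
    ultimately show ?thesis by simp
  qed
  show ?thesis
    using assms by (subst sum_over_permutations_insert) (simp_all add: ins add_ac)
qed

lemma covector_wedge_3:
  "covector_wedge [a, b, c] v =
    a (v 0) * (b (v 1) * c (v 2) - b (v 2) * c (v 1))
    - b (v 0) * (a (v 1) * c (v 2) - a (v 2) * c (v 1))
    + c (v 0) * (a (v 1) * b (v 2) - a (v 2) * b (v 1))"
proof -
  have "{..<length [a, b, c]} = {0, 1, 2}"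
    by auto
  then show ?thesis
    unfolding covector_wedge_def antisymmetrization_def
    by (simp add: sum_permutes_3 sign_compose sign_swap_id permutation_swap_id
        Transposition.transpose_def algebra_simps numeral_3_eq_3 numeral_2_eq_2)
qed

lemma interior_product_covector_wedge_3:
  "interior_product X (covector_wedge [a, b, c]) =
    (\<lambda>v. a X * covector_wedge [b, c] v - b X * covector_wedge [a, c] v + c X * covector_wedge [a, b] v)"
  by (simp add: interior_product_def covector_wedge_3 covector_wedge_2 fun_eq_iff numeral_2_eq_2)

section \<open>Bilinearity of the exterior product\<close>

lemma wedge_linear_left:
  "wedge k l (\<lambda>v. a v + b v) c = (\<lambda>v. wedge k l a c v + wedge k l b c v)"
  "wedge k l (\<lambda>v. a v - b v) c = (\<lambda>v. wedge k l a c v - wedge k l b c v)"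
  "wedge k l (\<lambda>v. r * a v) c = (\<lambda>v. r * wedge k l a c v)"
  by (auto simp: wedge_def fun_eq_iff algebra_simps sum.distrib sum_subtractf sum_distrib_left
      add_divide_distrib diff_divide_distrib)

lemma wedge_linear_right:
  "wedge k l c (\<lambda>v. a v + b v) = (\<lambda>v. wedge k l c a v + wedge k l c b v)"
  "wedge k l c (\<lambda>v. a v - b v) = (\<lambda>v. wedge k l c a v - wedge k l c b v)"
  "wedge k l c (\<lambda>v. r * a v) = (\<lambda>v. r * wedge k l c a v)"
  by (auto simp: wedge_def fun_eq_iff algebra_simps sum.distrib sum_subtractf sum_distrib_left
      add_divide_distrib diff_divide_distrib)

section \<open>Alternating forms of degree two and three\<close>

lemma is_form_cong:
  assumes "is_form k a" "\<And>i. i < k \<Longrightarrow> v i = w i"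
  shows "a v = a w"
  using assms(1)[unfolded is_form_def, THEN conjunct1] assms(2) by blast

lemma is_form_linear:
  assumes "is_form k a" "i < k"
  shows "linear (\<lambda>x. a (v(i := x)))"
  using assms(1)[unfolded is_form_def, THEN conjunct2, THEN conjunct1] assms(2) by blast

lemma is_form_alternating:
  assumes "is_form k a" "i < k" "j < k" "i \<noteq> j" "v i = v j"
  shows "a v = 0"
  using assms(1)[unfolded is_form_def, THEN conjunct2, THEN conjunct2] assms(2-) by blast

text \<open>Polarisation: with \<open>x + y\<close> in both slots the form vanishes, and the
  expansion leaves only the two mixed terms.\<close>

lemma is_form_swap:
  assumes a: "is_form k a" and ij: "i < k" "j < k" "i \<noteq> j"
  shows "a (v(i := x, j := y)) = - a (v(i := y, j := x))"
proof -
  let ?a = "\<lambda>x y. a (v(i := x, j := y))"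
  \<comment> \<open>\<open>is_form_linear\<close> speaks of the slot updated last, so linearity in
    slot \<open>i\<close> requires the updates in the other order.\<close>
  have twist: "v(j := z, i := x) = v(i := x, j := z)" for x z
    using ij(3) by (simp add: fun_upd_twist)
  have left: "?a (x + y) z = ?a x z + ?a y z" for x y z
    using linear_add[OF is_form_linear[OF a ij(1), of "v(j := z)"], of x y] by (simp only: twist)
  have right: "?a z (x + y) = ?a z x + ?a z y" for x y z
    using linear_add[OF is_form_linear[OF a ij(2), of "v(i := z)"], of x y] .
  have zero: "?a z z = 0" for z
    using ij(3) by (intro is_form_alternating[OF a ij]) simp
  show ?thesis
    using zero[of "x + y"] zero[of x] zero[of y] left[of x y "x + y"] right[of x x y] right[of y x y]
    by linarith
qed

text \<open>Currying turns the slots into separate arguments. The zeros filling the rest of the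
  sequence are invisible to a form of the matching degree.\<close>

definition eval2 :: "'v::zero form \<Rightarrow> 'v \<Rightarrow> 'v \<Rightarrow> real"
  where "eval2 a x y = a ((\<lambda>_. 0)(0 := x, 1 := y))"

definition eval3 :: "'v::zero form \<Rightarrow> 'v \<Rightarrow> 'v \<Rightarrow> 'v \<Rightarrow> real"
  where "eval3 a x y z = a ((\<lambda>_. 0)(0 := x, 1 := y, 2 := z))"

lemma is_form_eval2: "is_form 2 a \<Longrightarrow> a v = eval2 a (v 0) (v 1)"
  unfolding eval2_def by (rule is_form_cong) (auto simp: less_Suc_eq numeral_2_eq_2)

lemma is_form_eval3: "is_form 3 a \<Longrightarrow> a v = eval3 a (v 0) (v 1) (v 2)"
  unfolding eval3_def by (rule is_form_cong) (auto simp: less_Suc_eq numeral_3_eq_3 numeral_2_eq_2)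

lemma eval2_swap: "is_form 2 a \<Longrightarrow> eval2 a y x = - eval2 a x y"
  unfolding eval2_def by (rule is_form_swap) auto

text \<open>The order of updates decides which slots \<open>is_form_linear\<close> and
  \<open>is_form_swap\<close> can address; each variant puts the wanted slots last.\<close>

lemma eval3_alt:
  "eval3 a x y z = a ((\<lambda>_. 0)(1 := y, 2 := z, 0 := x))"
  "eval3 a x y z = a ((\<lambda>_. 0)(0 := x, 2 := z, 1 := y))"
  "eval3 a x y z = a ((\<lambda>_. 0)(2 := z, 0 := x, 1 := y))"
  unfolding eval3_def by (rule arg_cong[of _ _ a], rule ext, simp)+

lemma eval3_swap:
  assumes "is_form 3 a"
  shows "eval3 a y x z = - eval3 a x y z" "eval3 a x z y = - eval3 a x y z"
proof -
  show "eval3 a y x z = - eval3 a x y z"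
    unfolding eval3_alt(3) by (rule is_form_swap[OF assms]) simp_all
  show "eval3 a x z y = - eval3 a x y z"
    unfolding eval3_def by (rule is_form_swap[OF assms]) simp_all
qed

lemma eval3_same:
  assumes "is_form 3 a"
  shows "eval3 a x x z = 0" "eval3 a z x x = 0" "eval3 a x z x = 0"
proof -
  show same: "eval3 a x x z = 0" "eval3 a z x x = 0" for x z
    using eval3_swap(1)[OF assms, of x x z] eval3_swap(2)[OF assms, of z x x] by linarith+
  show "eval3 a x z x = 0"
    using eval3_swap(1)[OF assms, of x z x] same(2)[of z x] by simp
qed

lemma linear_eval3:
  assumes "is_form 3 a"
  shows "linear (\<lambda>x. eval3 a x y z)" "linear (\<lambda>x. eval3 a y x z)" "linear (\<lambda>x. eval3 a y z x)"
  unfolding eval3_alt(1)[of a _ y z] eval3_alt(2)[of a y _ z] eval3_def[of a y z]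
  by (rule is_form_linear[OF assms]; simp)+

text \<open>The 120 permutations fall into ten classes, one for each (2,3)-shuffle. Each class
  consists of 2! 3! = 12 equal terms, and the divisor in \<open>wedge\<close> removes this
  factor.\<close>

lemma wedge_2_3_shuffles:
  assumes a: "is_form 2 a" and b: "is_form 3 b"
  shows "wedge 2 3 a b v =
    eval2 a (v 0) (v 1) * eval3 b (v 2) (v 3) (v 4) - eval2 a (v 0) (v 2) * eval3 b (v 1) (v 3) (v 4)
    + eval2 a (v 0) (v 3) * eval3 b (v 1) (v 2) (v 4) - eval2 a (v 0) (v 4) * eval3 b (v 1) (v 2) (v 3)
    + eval2 a (v 1) (v 2) * eval3 b (v 0) (v 3) (v 4) - eval2 a (v 1) (v 3) * eval3 b (v 0) (v 2) (v 4)
    + eval2 a (v 1) (v 4) * eval3 b (v 0) (v 2) (v 3) + eval2 a (v 2) (v 3) * eval3 b (v 0) (v 1) (v 4)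
    - eval2 a (v 2) (v 4) * eval3 b (v 0) (v 1) (v 3) + eval2 a (v 3) (v 4) * eval3 b (v 0) (v 1) (v 2)"
proof -
  define F where "F \<sigma> = of_int (sign \<sigma>) * eval2 a (v (\<sigma> 0)) (v (\<sigma> 1)) *
    eval3 b (v (\<sigma> 2)) (v (\<sigma> 3)) (v (\<sigma> 4))" for \<sigma>
  let ?\<tau> = "\<lambda>i j :: nat. Transposition.transpose i j"
  \<comment> \<open>The sign of \<pi> cancels against the antisymmetry of \<open>b\<close>, so the
    six permutations of its slots contribute equally.\<close>
  have inner: "(\<Sum>\<pi> | \<pi> permutes {2, 3, 4}. F (\<rho> \<circ> \<pi>)) = 6 * F \<rho>" if \<rho>: "permutation \<rho>" for \<rho>
  proof -
    have perms: "eval3 b x z y = - eval3 b x y z" "eval3 b y x z = - eval3 b x y z"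
      "eval3 b y z x = eval3 b x y z" "eval3 b z x y = eval3 b x y z" "eval3 b z y x = - eval3 b x y z" for x y z
      using eval3_swap[OF b, of x y z] eval3_swap[OF b, of x z y] eval3_swap[OF b, of y x z]
        eval3_swap(1)[OF b, of y z x] by linarith+
    note perms = perms[where x = "v (\<rho> 2)" and y = "v (\<rho> 3)" and z = "v (\<rho> 4)"]
    have "distinct [2, 3, 4::nat]" by simp
    then show ?thesis
      by (simp only: sum_permutes_3)
        (simp add: F_def sign_compose sign_swap_id permutation_swap_id permutation_compose \<rho>
          Transposition.transpose_def, simp only: perms)
  qed
  \<comment> \<open>The representative \<open>?\<tau> 0 i \<circ> ?\<tau> 1 j\<close> fixes the two
    arguments of \<open>a\<close>: it sends 0 to \<open>i\<close>, and as \<open>j\<close> varies it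
    sends 1 to each of the other indices.\<close>
  have "(\<Sum>\<sigma> | \<sigma> permutes {..<2 + 3}. F \<sigma>) =
    (\<Sum>i\<in>{0, 1, 2, 3, 4}. \<Sum>j\<in>{1, 2, 3, 4}. \<Sum>\<pi> | \<pi> permutes {2, 3, 4}. F ((?\<tau> 0 i \<circ> ?\<tau> 1 j) \<circ> \<pi>))"
  proof -
    have "{..<2 + 3} = {0, 1, 2, 3, 4::nat}"
      by auto
    moreover have "(\<Sum>\<sigma> | \<sigma> permutes {0, 1, 2, 3, 4}. F \<sigma>) =
      (\<Sum>i\<in>{0, 1, 2, 3, 4}. \<Sum>\<sigma> | \<sigma> permutes {1, 2, 3, 4}. F (?\<tau> 0 i \<circ> \<sigma>))"
      by (rule sum_over_permutations_insert) auto
    moreover have "(\<Sum>\<sigma> | \<sigma> permutes {1, 2, 3, 4}. F (?\<tau> 0 i \<circ> \<sigma>)) =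
      (\<Sum>j\<in>{1, 2, 3, 4}. \<Sum>\<pi> | \<pi> permutes {2, 3, 4}. F (?\<tau> 0 i \<circ> (?\<tau> 1 j \<circ> \<pi>)))" for i
      by (rule sum_over_permutations_insert) auto
    ultimately have "(\<Sum>\<sigma> | \<sigma> permutes {..<2 + 3}. F \<sigma>) =
      (\<Sum>i\<in>{0, 1, 2, 3, 4}. \<Sum>j\<in>{1, 2, 3, 4}. \<Sum>\<pi> | \<pi> permutes {2, 3, 4}. F (?\<tau> 0 i \<circ> (?\<tau> 1 j \<circ> \<pi>)))"
      by (simp only:)
    then show ?thesis
      by (simp only: o_assoc)
  qed
  also have "\<dots> = (\<Sum>i\<in>{0, 1, 2, 3, 4}. \<Sum>j\<in>{1, 2, 3, 4}. 6 * F (?\<tau> 0 i \<circ> ?\<tau> 1 j))"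
    by (simp only: inner permutation_compose permutation_swap_id)
  \<comment> \<open>The 20 ordered pairs of arguments combine in twos by antisymmetry of
    \<open>a\<close>, which doubles the factor 6.\<close>
  also have "\<dots> = 12 * (
    eval2 a (v 0) (v 1) * eval3 b (v 2) (v 3) (v 4) - eval2 a (v 0) (v 2) * eval3 b (v 1) (v 3) (v 4)
    + eval2 a (v 0) (v 3) * eval3 b (v 1) (v 2) (v 4) - eval2 a (v 0) (v 4) * eval3 b (v 1) (v 2) (v 3)
    + eval2 a (v 1) (v 2) * eval3 b (v 0) (v 3) (v 4) - eval2 a (v 1) (v 3) * eval3 b (v 0) (v 2) (v 4)
    + eval2 a (v 1) (v 4) * eval3 b (v 0) (v 2) (v 3) + eval2 a (v 2) (v 3) * eval3 b (v 0) (v 1) (v 4)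
    - eval2 a (v 2) (v 4) * eval3 b (v 0) (v 1) (v 3) + eval2 a (v 3) (v 4) * eval3 b (v 0) (v 1) (v 2))"
  proof -
    have sort: "j < i \<Longrightarrow> eval2 a (v i) (v j) = - eval2 a (v j) (v i)"
      "j < i \<Longrightarrow> eval3 b (v i) (v j) (v k) = - eval3 b (v j) (v i) (v k)"
      "j < i \<Longrightarrow> eval3 b (v k) (v i) (v j) = - eval3 b (v k) (v j) (v i)" for i j k
      by (rule eval2_swap[OF a] eval3_swap(1)[OF b] eval3_swap(2)[OF b])+
    show ?thesis
      by (simp add: F_def sign_compose sign_swap_id permutation_swap_id
          Transposition.transpose_def) (simp add: sort)
  qed
  finally show ?thesis
    by (simp add: wedge_def F_def is_form_eval2[OF a] is_form_eval3[OF b] fact_numeral numeral_eq_Suc)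
qed

section \<open>The standard symplectic form\<close>

text \<open>Numbering the coordinates, 0 to 2 on the base and 3 to 5 on the fibre, lets repetition
  and order of the factors of a wedge be decided by computing with numbers.\<close>

definition phase_coord :: "nat \<Rightarrow> phase \<Rightarrow> real"
  where "phase_coord m v = [fst v $ 1, fst v $ 2, fst v $ 3, snd v $ 1, snd v $ 2, snd v $ 3] ! m"

definition coord_wedge :: "nat list \<Rightarrow> phase form"
  where "coord_wedge ns = covector_wedge (map phase_coord ns)"

lemma phase_coord_simps [simp]:
  "phase_coord 0 v = fst v $ 1" "phase_coord (Suc 0) v = fst v $ 2" "phase_coord 2 v = fst v $ 3"
  "phase_coord 3 v = snd v $ 1" "phase_coord 4 v = snd v $ 2" "phase_coord 5 v = snd v $ 3"
  by (simp_all add: phase_coord_def)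

lemma wedge_coord_wedge:
  "length as = k \<Longrightarrow> length bs = l \<Longrightarrow> wedge k l (coord_wedge as) (coord_wedge bs) = coord_wedge (as @ bs)"
  by (simp add: coord_wedge_def wedge_covector_wedge)

lemma coord_wedge_not_distinct: "\<not> distinct ns \<Longrightarrow> coord_wedge ns = (\<lambda>_. 0)"
  by (simp add: coord_wedge_def covector_wedge_not_distinct distinct_map)

lemma coord_wedge_swap: "coord_wedge (as @ i # j # bs) = (\<lambda>v. - coord_wedge (as @ j # i # bs) v)"
  unfolding coord_wedge_def map_append list.map by (rule ext) (rule covector_wedge_swap)

text \<open>As rewrite rules these perform a bubble sort: the condition \<open>j < i\<close>
  prevents looping, and increasing lists are the normal forms.\<close>

lemma coord_wedge_sort:
  "j < i \<Longrightarrow> coord_wedge [i, j, a, b, c, d] = (\<lambda>v. - coord_wedge [j, i, a, b, c, d] v)"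
  "j < i \<Longrightarrow> coord_wedge [a, i, j, b, c, d] = (\<lambda>v. - coord_wedge [a, j, i, b, c, d] v)"
  "j < i \<Longrightarrow> coord_wedge [a, b, i, j, c, d] = (\<lambda>v. - coord_wedge [a, b, j, i, c, d] v)"
  "j < i \<Longrightarrow> coord_wedge [a, b, c, i, j, d] = (\<lambda>v. - coord_wedge [a, b, c, j, i, d] v)"
  "j < i \<Longrightarrow> coord_wedge [a, b, c, d, i, j] = (\<lambda>v. - coord_wedge [a, b, c, d, j, i] v)"
  by (rule coord_wedge_swap[of "[]", simplified] coord_wedge_swap[of "[a]", simplified]
    coord_wedge_swap[of "[a, b]", simplified] coord_wedge_swap[of "[a, b, c]", simplified]
    coord_wedge_swap[of "[a, b, c, d]", simplified])+

text \<open>A frame on which the volume form is 1 allows it to be cancelled from the defining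
  equation of the metric.\<close>

lemma coord_wedge_volume_nonzero: "\<exists>v. coord_wedge [0, 1, 2, 3, 4, 5] v = 1"
proof
  let ?v = "(!) [(axis 1 1, 0), (axis 2 1, 0), (axis 3 1, 0), (0, axis 1 1), (0, axis 2 1), (0, axis 3 1)]"
  show "coord_wedge [0, 1, 2, 3, 4, 5] ?v = 1"
    unfolding coord_wedge_def
    by (rule covector_wedge_dual_basis)
      (auto simp: less_Suc_eq phase_coord_def numeral_eq_Suc axis_def)
qed

definition canonical_symplectic_form :: "phase form"
  where "canonical_symplectic_form = (\<lambda>v. coord_wedge [0, 3] v + coord_wedge [1, 4] v + coord_wedge [2, 5] v)"

section \<open>Mixed derivatives of the bilinear cost\<close>

lemma directional_eqI: "(f has_derivative f') (at x) \<Longrightarrow> directional v f x = f' v"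
  unfolding directional_def by (metis frechet_derivative_at)

lemma mixed_hessian_inner: "mixed_hessian (\<lambda>(x, y). - (x \<bullet> y)) z = mat (- 1)"
  for z :: "(real^'n::finite) \<times> (real^'n)"
proof -
  have "directional (0, axis j 1) (\<lambda>(x, y). - (x \<bullet> y)) = (\<lambda>w. - (fst w $ j))" for j :: 'n
  proof
    fix w :: "(real^'n) \<times> (real^'n)"
    have "((\<lambda>(x, y). - (x \<bullet> y)) has_derivative (\<lambda>h. - (fst w \<bullet> snd h + fst h \<bullet> snd w))) (at w)"
      unfolding case_prod_beta by (auto intro!: derivative_eq_intros)
    from directional_eqI[OF this]
    show "directional (0, axis j 1) (\<lambda>(x, y). - (x \<bullet> y)) w = - (fst w $ j)"
      by (simp add: inner_axis)
  qed
  moreover have "directional (axis i 1, 0) (\<lambda>w. - (fst w $ j)) z = - (if i = j then 1 else 0)" for i j :: 'n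
  proof -
    have "((\<lambda>w. - (fst w $ j)) has_derivative (\<lambda>h. - (fst h $ j))) (at z)"
      by (intro has_derivative_minus bounded_linear_imp_has_derivative
          bounded_linear_compose[OF bounded_linear_vec_nth bounded_linear_fst])
    from directional_eqI[OF this] show ?thesis
      by (simp add: axis_def)
  qed
  ultimately show ?thesis
    by (simp add: mixed_hessian_def mat_def vec_eq_iff)
qed

lemma mat_minus_one_mult: "mat (- 1) *v x = - x" for x :: "real^'n"
  by (simp add: vec_eq_iff matrix_vector_mult_def mat_def if_distrib[of "\<lambda>c. c * _"] cong: if_cong)

lemma uminus_mat_minus_one: "- mat (- 1) = (mat 1 :: real^'n^'n)"
  by (simp add: vec_eq_iff mat_def)

lemma symplectic_form_inner:
  "symplectic_form (\<lambda>(x, y). - (x \<bullet> y)) z =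
     (\<lambda>v. fst (v 0) \<bullet> snd (v 1) - snd (v 0) \<bullet> fst (v 1))"
  by (simp add: symplectic_form_def block_form_def mixed_hessian_inner fun_eq_iff
      mat_minus_one_mult uminus_mat_minus_one)

lemma symplectic_form_inner_3:
  "symplectic_form (\<lambda>(x, y). - (x \<bullet> y)) z = canonical_symplectic_form"
  unfolding symplectic_form_inner
  by (simp add: canonical_symplectic_form_def coord_wedge_def
      covector_wedge_2 fun_eq_iff inner_vec_def sum_3 algebra_simps)

lemma kmw_metric_inner:
  "kmw_metric (\<lambda>(x, y). - (x \<bullet> y)) \<rho> \<rho>' z V W =
    (\<rho> (fst z) * \<rho>' (snd z)) powr (1 / real CARD('n)) * (fst V \<bullet> snd W + snd V \<bullet> fst W)"
  for z :: "(real^'n) \<times> (real^'n)"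
proof -
  have "\<bar>det (mat (- 1) :: real^'n^'n)\<bar> = 1"
    by (subst det_diagonal) (simp_all add: mat_def)
  then show ?thesis
    by (simp add: kmw_metric_def block_form_def mixed_hessian_inner
      mat_minus_one_mult uminus_mat_minus_one)
qed

section \<open>The candidate 3-form and its exterior products\<close>

definition split_form :: "real \<Rightarrow> real \<Rightarrow> phase form"
  where "split_form r r' = (\<lambda>v. r' * coord_wedge [3, 4, 5] v - r * coord_wedge [0, 1, 2] v)"

text \<open>Each summand of the symplectic form pairs a base with a fibre covector, hence shares a
  factor with both the base and the fibre volume.\<close>

lemma effective_split_form: "wedge 2 3 canonical_symplectic_form (split_form r r') = (\<lambda>_. 0)"
  by (simp add: canonical_symplectic_form_def split_form_def wedge_linear_left wedge_linear_right
      wedge_coord_wedge coord_wedge_not_distinct)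

lemma interior_product_split_form:
  "interior_product X (split_form r r') = (\<lambda>v.
     r' * (snd X $ 1 * coord_wedge [4, 5] v - snd X $ 2 * coord_wedge [3, 5] v + snd X $ 3 * coord_wedge [3, 4] v) -
     r * (fst X $ 1 * coord_wedge [1, 2] v - fst X $ 2 * coord_wedge [0, 2] v + fst X $ 3 * coord_wedge [0, 1] v))"
proof -
  have "interior_product X (split_form r r') = (\<lambda>v.
     r' * interior_product X (coord_wedge [3, 4, 5]) v - r * interior_product X (coord_wedge [0, 1, 2]) v)"
    by (simp add: split_form_def interior_product_def)
  then show ?thesis
    by (simp add: coord_wedge_def interior_product_covector_wedge_3)
qed

text \<open>
  The sign comes from sorting: the coordinates \<open>0, 3, 1, 4, 2, 5\<close> are an odd permutation of \<open>0, \<dots>, 5\<close>.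
\<close>

lemma canonical_symplectic_volume:
  "wedge 4 2 (wedge 2 2 canonical_symplectic_form canonical_symplectic_form) canonical_symplectic_form v =
     - 6 * coord_wedge [0, 1, 2, 3, 4, 5] v"
  by (simp add: canonical_symplectic_form_def wedge_linear_left wedge_linear_right
      wedge_coord_wedge coord_wedge_not_distinct coord_wedge_sort)

text \<open>Only base terms times fibre terms survive, and the symplectic form must supply the
  conjugate pair missing from both, so equal indices of \<open>X\<close> and \<open>Y\<close> meet.
  The reorderings are even; the minus sign is the one in \<open>split_form\<close>.\<close>

lemma wedge_interior_product_split_form:
  "wedge 4 2 (wedge 2 2 (interior_product X (split_form r r')) (interior_product Y (split_form r r')))
     canonical_symplectic_form v =
     - (r * r' * (fst X \<bullet> snd Y + snd X \<bullet> fst Y)) * coord_wedge [0, 1, 2, 3, 4, 5] v"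
  by (simp add: canonical_symplectic_form_def interior_product_split_form
      wedge_linear_left wedge_linear_right wedge_coord_wedge coord_wedge_not_distinct coord_wedge_sort
      inner_vec_def sum_3 algebra_simps)

section \<open>The Monge--Ampere operator\<close>

lemma dx123_eq: "dx123 = covector_wedge [\<lambda>v. v $ 1, \<lambda>v. v $ 2, \<lambda>v. v $ 3]"
proof -
  have "dcoord i = covector_wedge [\<lambda>v. v $ i]" for i :: 3
    by (simp add: dcoord_def covector_wedge_1 fun_eq_iff)
  then show ?thesis
    by (simp add: dx123_def wedge_covector_wedge)
qed

text \<open>Multiplicativity of determinants, through which \<open>det (hessian u x)\<close> enters
  the operator.\<close>

lemma dx123_vector_matrix_mult: "dx123 (\<lambda>i. v i v* A) = det A * dx123 v"
  by (simp add: dx123_eq covector_wedge_3 det_3 vector_matrix_mult_def sum_3 algebra_simps)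

lemma split_form_eq: "split_form r r' v = r' * dx123 (\<lambda>i. snd (v i)) - r * dx123 (\<lambda>i. fst (v i))"
  by (simp add: split_form_def coord_wedge_def dx123_eq covector_wedge_3)

lemma is_form_covector_wedge_3:
  assumes "linear a" "linear b" "linear c"
  shows "is_form 3 (covector_wedge [a, b, c])"
proof -
  note lin = linear_add[OF assms(1)] linear_add[OF assms(2)] linear_add[OF assms(3)]
    linear_scale[OF assms(1)] linear_scale[OF assms(2)] linear_scale[OF assms(3)]
  have "linear (\<lambda>x. covector_wedge [a, b, c] (v(i := x)))" if "i < 3" for v i
    using that by (intro linearI) (auto simp: covector_wedge_3 lin algebra_simps less_Suc_eq numeral_3_eq_3)
  moreover have "covector_wedge [a, b, c] v = 0" if "i < 3" "j < 3" "i \<noteq> j" "v i = v j" for v i j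
    using that by (auto simp: covector_wedge_3 less_Suc_eq numeral_3_eq_3 numeral_2_eq_2 algebra_simps)
  ultimately show ?thesis
    by (auto simp: is_form_def covector_wedge_3)
qed

lemma is_form_diff_scale:
  assumes "is_form k a" "is_form k b"
  shows "is_form k (\<lambda>v. r * a v - s * b v)"
  using assms unfolding is_form_def
  by (auto intro!: linear_compose_sub linear_compose_scale_right[where 'b = real, simplified]) metis+

lemma is_form_split_form: "is_form 3 (split_form r r')"
  unfolding split_form_def coord_wedge_def list.map
  by (intro is_form_diff_scale is_form_covector_wedge_3 linearI)
    (simp_all add: phase_coord_def)

text \<open>The first index of \<open>hessian\<close> belongs to the outer derivative, so the
  direction is contracted with it; hence the row product \<open>v*\<close>.\<close>

lemma has_derivative_gradient:
  fixes u :: "real^'n \<Rightarrow> real"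
  assumes "smooth_on U u" "x \<in> U"
  shows "(gradient u has_derivative (\<lambda>h. h v* hessian u x)) (at x)"
  unfolding has_derivative_componentwise_within[of "gradient u"]
proof
  fix b :: "real^'n" assume "b \<in> Basis"
  then obtain i where b: "b = axis i 1"
    by (auto simp: Basis_vec_def)
  have "Ck_on (Suc (Suc 0)) U u"
    using assms(1) by (simp only: smooth_on_def)
  then have "directional b u differentiable at x"
    using assms(2) \<open>b \<in> Basis\<close> by auto
  then have der: "(directional b u has_derivative frechet_derivative (directional b u) (at x)) (at x)"
    by (simp add: frechet_derivative_works)
  then have lin: "linear (frechet_derivative (directional b u) (at x))"
    by (rule has_derivative_linear)
  have "frechet_derivative (directional b u) (at x) h = (h v* hessian u x) \<bullet> b" for h
  proof -
    have "frechet_derivative (directional b u) (at x) h =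
      frechet_derivative (directional b u) (at x) (\<Sum>j\<in>UNIV. h $ j *\<^sub>R axis j 1)"
      using basis_expansion[of h] by (simp add: scalar_mult_eq_scaleR)
    also have "\<dots> = (\<Sum>j\<in>UNIV. h $ j * directional (axis j 1) (directional b u) x)"
      by (simp add: linear_sum[OF lin] linear_scale[OF lin] directional_def)
    finally show ?thesis
      by (simp add: b inner_axis vector_matrix_mult_def hessian_def mult.commute)
  qed
  then have "frechet_derivative (directional b u) (at x) = (\<lambda>h. (h v* hessian u x) \<bullet> b)" ..
  moreover have "directional b u = (\<lambda>x. gradient u x \<bullet> b)"
    by (simp add: fun_eq_iff gradient_def b inner_axis)
  ultimately show "((\<lambda>x. gradient u x \<bullet> b) has_derivative (\<lambda>h. (h v* hessian u x) \<bullet> b)) (at x)"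
    using der by simp
qed

text \<open>The operator depends on \<alpha> only through its restriction to the tangent plane of
  the graph, which the 2-jet of \<open>u\<close> determines.\<close>

lemma monge_ampere_operator_eq:
  assumes "smooth_on U u" "x \<in> U"
  shows "monge_ampere_operator \<alpha> u x = (\<lambda>v. \<alpha> (x, gradient u x) (\<lambda>i. (v i, v i v* hessian u x)))"
proof -
  have "((\<lambda>x. (x, gradient u x)) has_derivative (\<lambda>h. (h, h v* hessian u x))) (at x)"
    by (intro has_derivative_Pair has_derivative_ident has_derivative_gradient[OF assms])
  then show ?thesis
    by (simp add: monge_ampere_operator_def pullback_def flip: frechet_derivative_at)
qed

lemma monge_ampere_operator_split_form:
  assumes "smooth_on U u" "x \<in> U"
  shows "monge_ampere_operator (\<lambda>z. split_form (\<rho> (fst z)) (\<rho>' (snd z))) u x =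
    (\<lambda>v. (\<rho>' (gradient u x) * det (hessian u x) - \<rho> x) * dx123 v)"
  by (simp add: monge_ampere_operator_eq[OF assms] split_form_eq dx123_vector_matrix_mult algebra_simps)

section \<open>Quadratic potentials with a prescribed 2-jet\<close>

lemma directional_const: "directional b (\<lambda>x. r) = (\<lambda>x. 0)"
  by (rule ext) (rule directional_eqI, rule has_derivative_const)

lemma Ck_on_const: "Ck_on k S (\<lambda>x. r)"
  by (induction k arbitrary: r) (simp_all add: directional_const)

lemma directional_inner: "directional b (\<lambda>x. r + a \<bullet> x) = (\<lambda>x. a \<bullet> b)"
  by (rule ext, rule directional_eqI) (auto intro!: derivative_eq_intros)

lemma Ck_on_inner: "Ck_on k S (\<lambda>x. r + a \<bullet> x)"
  by (cases k) (auto simp: directional_inner Ck_on_const intro!: continuous_intros derivative_intros)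

definition quadratic :: "real^'n \<Rightarrow> real^'n^'n \<Rightarrow> real^'n \<Rightarrow> real"
  where "quadratic a H x = a \<bullet> x + x \<bullet> (H *v x) / 2"

lemma has_derivative_quadratic:
  assumes "transpose H = H"
  shows "(quadratic a H has_derivative (\<lambda>h. (a + H *v x) \<bullet> h)) (at x)"
proof -
  have sym: "x \<bullet> (H *v h) = h \<bullet> (H *v x)" for h
    using assms by (metis dot_lmul_matrix inner_commute transpose_matrix_vector)
  have "((*v) H has_derivative (*v) H) (at x)"
    by (simp add: bounded_linear_imp_has_derivative)
  then have "(quadratic a H has_derivative (\<lambda>h. a \<bullet> h + (x \<bullet> (H *v h) + h \<bullet> (H *v x)) / 2)) (at x)"
    unfolding quadratic_def[abs_def] by (auto intro!: derivative_eq_intros)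
  then show ?thesis
    by (simp add: sym inner_add_left inner_commute[of _ "H *v x"])
qed

lemma directional_quadratic:
  assumes "transpose H = H"
  shows "directional b (quadratic a H) = (\<lambda>x. a \<bullet> b + (H *v b) \<bullet> x)"
proof
  fix x
  have "(H *v x) \<bullet> b = (H *v b) \<bullet> x"
    using assms by (metis dot_lmul_matrix inner_commute transpose_matrix_vector)
  then show "directional b (quadratic a H) x = a \<bullet> b + (H *v b) \<bullet> x"
    by (simp add: directional_eqI[OF has_derivative_quadratic[OF assms]] inner_add_left)
qed

lemma smooth_on_quadratic:
  assumes "transpose H = H"
  shows "smooth_on S (quadratic a H)"
  unfolding smooth_on_def
proof
  fix k
  have "quadratic a H differentiable at x" for x
    using has_derivative_quadratic[OF assms] unfolding differentiable_def by blast
  then show "Ck_on k S (quadratic a H)"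
    by (cases k) (auto simp: directional_quadratic[OF assms] Ck_on_inner
        intro!: continuous_at_imp_continuous_on differentiable_imp_continuous_within)
qed

lemma gradient_quadratic: "transpose H = H \<Longrightarrow> gradient (quadratic a H) x = a + H *v x"
  by (simp add: gradient_def vec_eq_iff directional_eqI[OF has_derivative_quadratic] inner_axis)

lemma hessian_quadratic:
  fixes x :: "real^'n"
  assumes "transpose H = H"
  shows "hessian (quadratic a H) x = H"
proof -
  have "directional b (\<lambda>x. r + c \<bullet> x) x = c \<bullet> b" for b c :: "real^'n" and r
    by (simp add: directional_inner)
  then have "hessian (quadratic a H) x $ i $ j = (H *v axis j 1) $ i" for i j
    by (simp add: hessian_def directional_quadratic[OF assms] inner_axis)
  then show ?thesis
    by (simp add: vec_eq_iff matrix_vector_mult_basis column_def)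
qed

text \<open>The linear coefficient \<open>p - H *v x\<close> compensates for the gradient
  \<open>H *v x\<close> of the quadratic part at \<open>x\<close>.\<close>

lemma exists_smooth_jet:
  assumes "transpose H = H"
  shows "\<exists>u. smooth_on UNIV u \<and> gradient u x = p \<and> hessian u x = H"
  by (rule exI[of _ "quadratic (p - H *v x) H"])
    (simp add: assms smooth_on_quadratic gradient_quadratic hessian_quadratic)

section \<open>Uniqueness of the effective form\<close>

lemma canonical_symplectic_form_eq:
  "canonical_symplectic_form v = fst (v 0) \<bullet> snd (v 1) - snd (v 0) \<bullet> fst (v 1)"
  by (simp add: canonical_symplectic_form_def coord_wedge_def covector_wedge_2 inner_vec_def sum_3)

lemma is_form_canonical_symplectic_form: "is_form 2 canonical_symplectic_form"
proof -
  have "linear (\<lambda>x. canonical_symplectic_form (v(i := x)))" if "i < 2" for v i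
    using that by (intro linearI) (auto simp: canonical_symplectic_form_eq less_Suc_eq numeral_2_eq_2
        inner_add_left inner_add_right algebra_simps)
  moreover have "canonical_symplectic_form v = 0" if "i < 2" "j < 2" "i \<noteq> j" "v i = v j" for v i j
    using that by (auto simp: canonical_symplectic_form_eq less_Suc_eq numeral_2_eq_2 inner_commute)
  ultimately show ?thesis
    by (auto simp: is_form_def canonical_symplectic_form_eq)
qed

lemma eval2_canonical_symplectic_form:
  "eval2 canonical_symplectic_form x y = fst x \<bullet> snd y - snd x \<bullet> fst y"
  by (simp add: eval2_def canonical_symplectic_form_eq)

abbreviation base_axis :: "3 \<Rightarrow> phase"
  where "base_axis i \<equiv> (axis i 1, 0)"

abbreviation fibre_axis :: "3 \<Rightarrow> phase"
  where "fibre_axis i \<equiv> (0, axis i 1)"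

text \<open>Evaluated on two conjugate pairs and \<open>w\<close>, the product keeps two of its ten
  shuffles, because \<open>w\<close> and vectors of different pairs are symplectically
  orthogonal.\<close>

lemma effective_eval3:
  assumes b: "is_form 3 b" and eff: "wedge 2 3 canonical_symplectic_form b = (\<lambda>_. 0)"
    and ijk: "i \<noteq> j" "i \<noteq> k" "j \<noteq> k" and w: "w \<in> {base_axis k, fibre_axis k}"
  shows "eval3 b (base_axis i) (fibre_axis i) w = - eval3 b (base_axis j) (fibre_axis j) w"
proof -
  let ?v = "(!) [base_axis i, fibre_axis i, base_axis j, fibre_axis j, w]"
  have "wedge 2 3 canonical_symplectic_form b ?v = 0"
    by (simp add: eff)
  then show ?thesis
    unfolding wedge_2_3_shuffles[OF is_form_canonical_symplectic_form b] eval2_canonical_symplectic_form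
    using ijk w by (auto simp: inner_axis_axis)
qed

text \<open>
  Diagonal Hessians kill the components with three distinct indices.  Off-diagonal ones identify the
  components with a pair of conjugate directions in positions \<open>i\<close> and \<open>j\<close>, and effectiveness says
  that these are opposite.
\<close>

lemma eval3_zero_if_zero_on_graphs:
  assumes b: "is_form 3 b" and eff: "wedge 2 3 canonical_symplectic_form b = (\<lambda>_. 0)"
    and graph: "\<And>H v. transpose H = H \<Longrightarrow> b (\<lambda>i. (v i, H *v v i)) = 0"
    and ijk: "i \<noteq> j" "i \<noteq> k" "j \<noteq> k"
    and x: "x \<in> {base_axis i, fibre_axis i}"
    and y: "y \<in> {base_axis i, fibre_axis i, base_axis j, fibre_axis j}"
    and z: "z \<in> {base_axis k, fibre_axis k}"
  shows "eval3 b x y z = 0"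
proof -
  note add = linear_add[OF linear_eval3(1)[OF b]] linear_add[OF linear_eval3(2)[OF b]]
    linear_add[OF linear_eval3(3)[OF b]]
  have graph3: "eval3 b (p, H *v p) (q, H *v q) (r, H *v r) = 0" if "transpose H = H" for H p q r
    using graph[OF that, of "(!) [p, q, r]"] by (simp add: is_form_eval3[OF b])
  have diagonal: "eval3 b (axis i 1, axis i s) (axis j 1, axis j t) (axis k 1, axis k u) = 0" for s t u
  proof -
    define d where "d m = (if m = i then s else if m = j then t else u)" for m
    define H :: "real^3^3" where "H = (\<chi> m n. if m = n then d m else 0)"
    have "transpose H = H"
      by (simp add: H_def transpose_def vec_eq_iff)
    moreover have "H *v axis m 1 = axis m (d m)" for m
      unfolding matrix_vector_mult_basis by (simp add: H_def column_def axis_def vec_eq_iff)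
    ultimately show ?thesis
      using graph3[of H "axis i 1" "axis j 1" "axis k 1"] ijk by (simp add: d_def)
  qed
  have split: "(axis m 1, axis m (of_bool p)) =
    (if p then base_axis m + fibre_axis m else base_axis m)" for m p
    by (auto simp: axis_def vec_eq_iff)
  \<comment> \<open>The eight patterns of 0/1 diagonal entries give a triangular system: by
    increasing number of fibre vectors, each relation contains one new component.\<close>
  have distinct: "eval3 b x y z = 0"
    if "x \<in> {base_axis i, fibre_axis i}" "y \<in> {base_axis j, fibre_axis j}" "z \<in> {base_axis k, fibre_axis k}"
    for x y z
  proof -
    have D: "eval3 b (if p then base_axis i + fibre_axis i else base_axis i)
      (if q then base_axis j + fibre_axis j else base_axis j)
      (if r then base_axis k + fibre_axis k else base_axis k) = 0" for p q r
      using diagonal[of "of_bool p" "of_bool q" "of_bool r"] unfolding split .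
    show ?thesis
      using D[of False False False] D[of True False False] D[of False True False] D[of False False True]
        D[of True True False] D[of True False True] D[of False True True] D[of True True True] that
      unfolding if_True if_False add by auto
  qed
  \<comment> \<open>The free entry \<open>u\<close> at position \<open>k\<close> lets the third slot
    be \<open>base_axis k\<close> or its sum with \<open>fibre_axis k\<close>, hence either axis by
    linearity.\<close>
  have off_diagonal: "eval3 b (axis i 1, axis j 1) (axis j 1, axis i 1) (axis k 1, axis k u) = 0" for u
  proof -
    define H :: "real^3^3" where
      "H = (\<chi> m n. if m = i \<and> n = j \<or> m = j \<and> n = i then 1 else if m = k \<and> n = k then u else 0)"
    have "transpose H = H"
      using ijk by (auto simp: H_def transpose_def vec_eq_iff)
    moreover have "H *v axis i 1 = axis j 1" "H *v axis j 1 = axis i 1" "H *v axis k 1 = axis k u"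
      unfolding matrix_vector_mult_basis using ijk by (auto simp: H_def column_def axis_def vec_eq_iff)
    ultimately show ?thesis
      using graph3[of H "axis i 1" "axis j 1" "axis k 1"] by simp
  qed
  have pair: "eval3 b (base_axis i) (fibre_axis i) z = 0"
  proof -
    have off: "eval3 b (base_axis i + fibre_axis j) (base_axis j + fibre_axis i)
        (if p then base_axis k + fibre_axis k else base_axis k) = 0" for p
    proof -
      have "(axis i 1, axis j 1) = base_axis i + fibre_axis j" "(axis j 1, axis i 1) = base_axis j + fibre_axis i"
        by simp_all
      then show ?thesis
        using off_diagonal[of "of_bool p"] unfolding split by simp
    qed
    have "eval3 b (base_axis i + fibre_axis j) (base_axis j + fibre_axis i) z = 0"
      using off[of True] off[of False] z unfolding if_True if_False add(3) by auto
    moreover have "eval3 b (base_axis i) (base_axis j) z = 0" "eval3 b (fibre_axis i) (fibre_axis j) z = 0"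
      using z by (auto intro!: distinct)
    moreover have "eval3 b (base_axis i) (fibre_axis i) z = - eval3 b (base_axis j) (fibre_axis j) z"
      by (rule effective_eval3[OF b eff ijk z])
    ultimately show ?thesis
      using eval3_swap(1)[OF b, of "fibre_axis i" "fibre_axis j" z]
        eval3_swap(1)[OF b, of "base_axis j" "fibre_axis j" z]
      unfolding add by linarith
  qed
  show ?thesis
    using x y z distinct pair eval3_swap(1)[OF b, of "base_axis i" "fibre_axis i" z] eval3_same(1)[OF b]
    by (auto simp del: prod.inject)
qed

text \<open>By trilinearity basis vectors suffice. If exactly two indices agree, swaps bring them to
  the front, and the dimension 3 supplies the further index \<open>m\<close> that the effectiveness
  relation compares with.\<close>

lemma form_zero_if_zero_on_graphs:
  assumes b: "is_form 3 b" and eff: "wedge 2 3 canonical_symplectic_form b = (\<lambda>_. 0)"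
    and graph: "\<And>H v. transpose H = H \<Longrightarrow> b (\<lambda>i. (v i, H *v v i)) = 0"
  shows "b v = 0"
proof -
  note vanish = eval3_zero_if_zero_on_graphs[OF b eff graph]
  have basis: "eval3 b x y z = 0" if xyz: "x \<in> Basis" "y \<in> Basis" "z \<in> Basis" for x y z :: phase
  proof -
    have axis: "\<exists>i. w \<in> {base_axis i, fibre_axis i}" if "w \<in> Basis" for w :: phase
      using that by (auto simp: Basis_prod_def Basis_vec_def)
    obtain i j k where x: "x \<in> {base_axis i, fibre_axis i}" and y: "y \<in> {base_axis j, fibre_axis j}"
      and z: "z \<in> {base_axis k, fibre_axis k}"
      using axis[OF xyz(1)] axis[OF xyz(2)] axis[OF xyz(3)] by blast
    have third: "\<exists>m. m \<noteq> i \<and> m \<noteq> j" for i j :: 3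
    proof -
      have "card {i, j} < CARD(3)"
        by (simp add: card_insert_if)
      then have "{i, j} \<noteq> UNIV"
        by (metis less_irrefl)
      then show ?thesis
        by blast
    qed
    consider "i = j" "j = k" | "i = j" "i \<noteq> k" | "i = k" "i \<noteq> j" | "j = k" "i \<noteq> j"
      | "i \<noteq> j" "i \<noteq> k" "j \<noteq> k"
      by blast
    then show ?thesis
    proof cases
      \<comment> \<open>Three arguments are drawn from the two vectors with index \<open>i\<close>,
        so two of them coincide.\<close>
      case 1
      then show ?thesis
        using x y z eval3_same[OF b] by (auto simp del: prod.inject)
    next
      case 2
      then obtain m where "m \<noteq> i" "m \<noteq> k"
        using third by blast
      with 2 show ?thesis
        using x y z by (intro vanish[of i m k]) auto
    next
      case 3
      then obtain m where "m \<noteq> i" "m \<noteq> j"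
        using third by blast
      with 3 have "eval3 b x z y = 0"
        using x y z by (intro vanish[of i m j]) auto
      then show ?thesis
        using eval3_swap(2)[OF b, of x z y] by simp
    next
      case 4
      then obtain m where "m \<noteq> i" "m \<noteq> j"
        using third by blast
      with 4 have "eval3 b y z x = 0"
        using x y z by (intro vanish[of j m i]) auto
      then show ?thesis
        using eval3_swap(2)[OF b, of y z x] eval3_swap(1)[OF b, of x y z] by simp
    next
      case 5
      then show ?thesis
        using x y z by (intro vanish[of i j k]) auto
    qed
  qed
  have "eval3 b x y = (\<lambda>z. 0)" if "x \<in> Basis" "y \<in> Basis" for x y
    by (rule linear_eq_stdbasis[OF linear_eval3(3)[OF b] linear_zero]) (rule basis[OF that])
  then have "(\<lambda>y. eval3 b x y z) = (\<lambda>y. 0)" if "x \<in> Basis" for x z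
    by (intro linear_eq_stdbasis[OF linear_eval3(2)[OF b] linear_zero]) (simp add: that)
  then have "(\<lambda>x. eval3 b x y z) = (\<lambda>x. 0)" for y z
    by (intro linear_eq_stdbasis[OF linear_eval3(1)[OF b] linear_zero]) meson
  then have "eval3 b x y z = 0" for x y z
    by meson
  then show ?thesis
    by (simp add: is_form_eval3[OF b])
qed

section \<open>Determination of the effective form and of its metric\<close>

lemma corresponding_form_eq:
  "corresponding_form (symplectic_form (\<lambda>(x, y). - (x \<bullet> y))) \<rho> \<rho>' =
    (\<lambda>z. split_form (\<rho> (fst z)) (\<rho>' (snd z)))"
  unfolding corresponding_form_def effective_def symplectic_form_inner_3
proof (rule the_equality, goal_cases)
  case 1
  show ?case
    by (simp add: is_form_split_form effective_split_form monge_ampere_operator_split_form)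
next
  case (2 \<alpha>)
  then have form: "is_form 3 (\<alpha> z)" and eff: "wedge 2 3 canonical_symplectic_form (\<alpha> z) = (\<lambda>_. 0)"
    and op: "open U \<Longrightarrow> smooth_on U u \<Longrightarrow> x \<in> U \<Longrightarrow> monge_ampere_operator \<alpha> u x =
      (\<lambda>v. (\<rho>' (gradient u x) * det (hessian u x) - \<rho> x) * dx123 v)" for z U u x
    by blast+
  show ?case
  proof (intro ext)
    fix z v
    let ?s = "split_form (\<rho> (fst z)) (\<rho>' (snd z))"
    \<comment> \<open>The difference of two candidates is effective and vanishes on graphs of
      symmetric matrices. The factors 1 give it the shape of
      \<open>is_form_diff_scale\<close>.\<close>
    let ?b = "\<lambda>v. 1 * \<alpha> z v - 1 * ?s v"
    have "is_form 3 ?b"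
      by (intro is_form_diff_scale form is_form_split_form)
    moreover have "wedge 2 3 canonical_symplectic_form ?b = (\<lambda>_. 0)"
      by (simp only: wedge_linear_right eff effective_split_form) simp
    moreover have "?b (\<lambda>i. (v i, H *v v i)) = 0" if H: "transpose H = H" for H v
    proof -
      obtain u where u: "smooth_on UNIV u" "gradient u (fst z) = snd z" "hessian u (fst z) = H"
        using exists_smooth_jet[OF H] by blast
      have "\<alpha> z (\<lambda>i. (v i, v i v* H)) = ?s (\<lambda>i. (v i, v i v* H))"
        using fun_cong[OF op[OF open_UNIV u(1) UNIV_I, of "fst z"], of v]
          fun_cong[OF monge_ampere_operator_split_form[OF u(1) UNIV_I, of \<rho> \<rho>' "fst z"], of v]
        by (simp add: monge_ampere_operator_eq[OF u(1) UNIV_I] u(2,3))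
      then show ?thesis
        using H transpose_matrix_vector[of H] by simp
    qed
    ultimately have "?b v = 0"
      by (rule form_zero_if_zero_on_graphs)
    then show "\<alpha> z v = ?s v"
      by simp
  qed
qed

text \<open>Division by \<open>fact 3\<close> turns the volume coefficient -6 into -1, which cancels
  the sign on the other side. Evaluation on a frame of volume 1 then determines each value of the
  metric.\<close>

lemma lychagin_rubtsov_metric_split_form:
  "lychagin_rubtsov_metric (symplectic_form (\<lambda>(x, y). - (x \<bullet> y))) (\<lambda>z. split_form (r z) (r' z)) =
    (\<lambda>z X Y. r z * r' z * (fst X \<bullet> snd Y + snd X \<bullet> fst Y))"
  unfolding lychagin_rubtsov_metric_def symplectic_form_inner_3 canonical_symplectic_volume
    wedge_interior_product_split_form
proof (rule the_equality, goal_cases)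
  case 1
  show ?case
    by (auto simp: bilinear_def fact_numeral inner_commute add.commute inner_add_left inner_add_right
        algebra_simps intro!: linearI)
next
  case (2 g)
  obtain v where v: "coord_wedge [0, 1, 2, 3, 4, 5] v = 1"
    using coord_wedge_volume_nonzero by blast
  show ?case
  proof (intro ext)
    fix z X Y
    from 2 have "(\<lambda>v. g z X Y * (- 6 * coord_wedge [0, 1, 2, 3, 4, 5] v / fact 3)) =
      (\<lambda>v. - (r z * r' z * (fst X \<bullet> snd Y + snd X \<bullet> fst Y)) * coord_wedge [0, 1, 2, 3, 4, 5] v)"
      by blast
    from fun_cong[OF this, of v]
    show "g z X Y = r z * r' z * (fst X \<bullet> snd Y + snd X \<bullet> fst Y)"
      unfolding v by (simp add: fact_numeral)
  qed
qed

theorem proposition2p1: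
  fixes \<rho> \<rho>' :: "real^3 \<Rightarrow> real"
    and c :: "(real^3) \<times> (real^3) \<Rightarrow> real"
  assumes "prob_density \<rho>"
    and "prob_density \<rho>'"
    and "c = (\<lambda>(x, y). - (x \<bullet> y))"
  shows "lychagin_rubtsov_metric (symplectic_form c)
           (corresponding_form (symplectic_form c) \<rho> \<rho>') =
         (\<lambda>z V W. (\<rho> (fst z) * \<rho>' (snd z)) powr (2/3) * kmw_metric c \<rho> \<rho>' z V W)"
proof -
  \<comment> \<open>Nonnegativity makes \<open>(\<rho> x * \<rho>' y) powr 1\<close> equal to the
    product itself, also where a density vanishes.\<close>
  have "\<rho> x * \<rho>' y \<ge> 0" for x y
    using assms(1,2) by (simp add: prob_density_def)
  then have powers: "(\<rho> x * \<rho>' y) powr (2 / 3) * ((\<rho> x * \<rho>' y) powr (1 / 3) * t) = \<rho> x * \<rho>' y * t" for x y t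
    by (simp flip: mult.assoc powr_add)
  show ?thesis
    unfolding assms(3) corresponding_form_eq lychagin_rubtsov_metric_split_form kmw_metric_inner
    by (simp add: powers)
qed

end
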